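(* Let $S, T, F$ be semigroups such that $S\times T$ is finitely generated, and let $\varphi : S \to F$, $\psi : T \to F$ be epimorphisms such that the fiber product $\Pi(\varphi,\psi) = \{(s,t) \in S\times T : \varphi(s) = \psi(t)\}$ is finitely generated. Then the generalized word problem for $\Pi(\varphi,\psi)$ in $S\times T$ is decidable if and only if the word problem of $F$ is decidable.
   Context: "Epimorphism" means surjective homomorphism. Under these hypotheses $F$ is finitely generated. For a semigroup $F$ with finite generating set $Y$, the word problem is the set $\mathrm{WP}(F,Y) = \{(u,v) \in Y^{+}\times Y^{+} : u =_{F} v\}$, where $u =_F v$ means that the words $u$ and $v$ represent the same element of $F$; the word problem of $F$ is decidable if there is an algorithm deciding membership of pairs $(u,v) \in Y^{+}\times Y^{+}$ in $\mathrm{WP}(F,Y)$ (this does not depend on the choice of finite generating set $Y$). For a finitely generated semigroup $P$ with finite generating set $X$ and a finitely generated subsemigroup $U \le P$, the generalized word problem of $U$ in $P$ is the set of words over $X$ representing an element of $U$; it is decidable if there is an algorithm deciding membership of words over $X$ in this set (again independent of the choice of finite generating set $X$). *)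

theory Defs
  imports "HOL-Algebra.Group" "HOL-Library.Nat_Bijection" "HOL-Library.Countable_Set"
begin

section \<open>Recursive functions\<close>

datatype recf =
    Zero
  | Succ
  | Proj nat
  | Comp recf "recf list"
  | Prim recf recf
  | Minim recf

text \<open>
  \<open>rec_eval f xs y\<close>: the partial recursive function denoted by \<open>f\<close> is defined at the argument
  tuple \<open>xs\<close> and its value there is \<open>y\<close>.  The first argument is the recursion variable of
  \<open>Prim f g\<close>, and the search variable is the first argument of \<open>f\<close> in \<open>Minim f\<close>; all values
  below the result of the search must be defined and nonzero.
\<close>

inductive rec_eval :: "recf \<Rightarrow> nat list \<Rightarrow> nat \<Rightarrow> bool" where
  Zero: "rec_eval Zero xs 0"
| Succ: "rec_eval Succ [x] (Suc x)"
| Proj: "i < length xs \<Longrightarrow> rec_eval (Proj i) xs (xs ! i)"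
| Comp: "list_all2 (\<lambda>g y. rec_eval g xs y) gs ys \<Longrightarrow> rec_eval f ys z
    \<Longrightarrow> rec_eval (Comp f gs) xs z"
| Prim_0: "rec_eval f xs y \<Longrightarrow> rec_eval (Prim f g) (0 # xs) y"
| Prim_Suc: "rec_eval (Prim f g) (n # xs) r \<Longrightarrow> rec_eval g (n # r # xs) y
    \<Longrightarrow> rec_eval (Prim f g) (Suc n # xs) y"
| Minim: "rec_eval f (n # xs) 0 \<Longrightarrow> (\<forall>m<n. \<exists>k. rec_eval f (m # xs) (Suc k))
    \<Longrightarrow> rec_eval (Minim f) xs n"
  monos list_all2_mono

inductive_cases rec_eval_ZeroE: "rec_eval Zero xs y"
inductive_cases rec_eval_SuccE: "rec_eval Succ xs y"
inductive_cases rec_eval_ProjE: "rec_eval (Proj i) xs y"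
inductive_cases rec_eval_CompE: "rec_eval (Comp f gs) xs y"
inductive_cases rec_eval_Prim_0E: "rec_eval (Prim f g) (0 # xs) y"
inductive_cases rec_eval_Prim_SucE: "rec_eval (Prim f g) (Suc n # xs) y"
inductive_cases rec_eval_MinimE: "rec_eval (Minim f) xs y"

lemma rec_eval_deterministic:
  assumes "rec_eval f xs y" "rec_eval f xs z"
  shows "y = z"
  using assms
proof (induction arbitrary: z rule: rec_eval.induct)
  case (Zero xs)
  then show ?case by (auto elim: rec_eval_ZeroE)
next
  case (Succ x)
  then show ?case by (auto elim: rec_eval_SuccE)
next
  case (Proj i xs)
  then show ?case by (auto elim: rec_eval_ProjE)
next
  case (Comp xs gs ys f y)
  from Comp.prems obtain ys' where ys': "list_all2 (\<lambda>g y. rec_eval g xs y) gs ys'"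
    and z: "rec_eval f ys' z"
    by (blast elim: rec_eval_CompE)
  have "ys = ys'"
  proof (rule nth_equalityI)
    show "length ys = length ys'"
      using Comp.IH(1) ys' by (simp add: list_all2_conv_all_nth)
    show "ys ! i = ys' ! i" if "i < length ys" for i
      using Comp.IH(1) ys' that by (simp add: list_all2_conv_all_nth)
  qed
  with z Comp.IH(2) show ?case by blast
next
  case (Prim_0 f xs y g)
  then show ?case by (blast elim: rec_eval_Prim_0E)
next
  case (Prim_Suc f g n xs r y)
  from Prim_Suc.prems obtain r' where "rec_eval (Prim f g) (n # xs) r'"
    and "rec_eval g (n # r' # xs) z"
    by (blast elim: rec_eval_Prim_SucE)
  moreover from this have "r = r'" using Prim_Suc.IH(1) by blast
  ultimately show ?case using Prim_Suc.IH(2) by blast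
next
  case (Minim f n xs)
  from Minim.prems have z: "rec_eval f (z # xs) 0"
    and below: "\<forall>m<z. \<exists>k. rec_eval f (m # xs) (Suc k)"
    by - (erule rec_eval_MinimE, assumption)+
  have "\<not> n < z"
  proof
    assume "n < z"
    with below obtain k where "rec_eval f (n # xs) (Suc k)" by blast
    then have "0 = Suc k" by (rule Minim.IH(1))
    then show False by simp
  qed
  moreover have "\<not> z < n"
  proof
    assume "z < n"
    with Minim.IH(2) obtain k where "\<And>y. rec_eval f (z # xs) y \<Longrightarrow> Suc k = y" by blast
    from this[OF z] show False by simp
  qed
  ultimately show ?case by simp
qed

definition decidable_set :: "nat set \<Rightarrow> bool" where
  "decidable_set A \<longleftrightarrow> (\<exists>f. \<forall>n. rec_eval f [n] (if n \<in> A then 1 else 0))"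


section \<open>Decidable sets of words\<close>

definition nonempty_words :: "'a set \<Rightarrow> 'a list set" where
  "nonempty_words X = {w \<in> lists X. w \<noteq> []}"

text \<open>
  The letters of a finite alphabet \<open>X\<close> are numbered by the fixed bijection \<open>to_nat_on X\<close> from
  \<open>X\<close> onto \<open>{..<card X}\<close>.
\<close>

definition word_code :: "'a set \<Rightarrow> 'a list \<Rightarrow> nat" where
  "word_code X w = list_encode (map (to_nat_on X) w)"

definition decidable_words :: "'a set \<Rightarrow> 'a list set \<Rightarrow> bool" where
  "decidable_words X L \<longleftrightarrow> decidable_set (word_code X ` L)"

definition decidable_word_pairs :: "'a set \<Rightarrow> ('a list \<times> 'a list) set \<Rightarrow> bool" where
  "decidable_word_pairs X R \<longleftrightarrow>
     decidable_set ((\<lambda>(u, v). prod_encode (word_code X u, word_code X v)) ` R)"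


section \<open>Semigroups\<close>

text \<open>
  Semigroups use the monoid records of HOL-Algebra, so that \<open>hom\<close>, \<open>epi\<close> and \<open>\<times>\<times>\<close> apply; the
  field \<open>one\<close> is arbitrary and never referred to.
\<close>

locale alg_semigroup =
  fixes G (structure)
  assumes m_closed: "\<lbrakk>x \<in> carrier G; y \<in> carrier G\<rbrakk> \<Longrightarrow> x \<otimes> y \<in> carrier G"
    and m_assoc: "\<lbrakk>x \<in> carrier G; y \<in> carrier G; z \<in> carrier G\<rbrakk>
      \<Longrightarrow> (x \<otimes> y) \<otimes> z = x \<otimes> (y \<otimes> z)"

text \<open>The value on the empty word is unspecified; only nonempty words are ever evaluated.\<close>

fun word_value :: "('a, 'm) monoid_scheme \<Rightarrow> 'a list \<Rightarrow> 'a" where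
  "word_value G [x] = x"
| "word_value G (x # y # w) = x \<otimes>\<^bsub>G\<^esub> word_value G (y # w)"

definition generating_set :: "('a, 'm) monoid_scheme \<Rightarrow> 'a set \<Rightarrow> bool" where
  "generating_set G X \<longleftrightarrow> X \<subseteq> carrier G \<and> carrier G = word_value G ` nonempty_words X"

definition finitely_generated :: "('a, 'm) monoid_scheme \<Rightarrow> bool" where
  "finitely_generated G \<longleftrightarrow> (\<exists>X. finite X \<and> generating_set G X)"

definition fiber_product ::
  "('a, 'm) monoid_scheme \<Rightarrow> ('b, 'n) monoid_scheme \<Rightarrow> ('a \<Rightarrow> 'c) \<Rightarrow> ('b \<Rightarrow> 'c) \<Rightarrow> ('a \<times> 'b) set" where
  "fiber_product S T \<phi> \<psi> = {(s, t) \<in> carrier (S \<times>\<times> T). \<phi> s = \<psi> t}"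


section \<open>Word problem and generalized word problem\<close>

definition word_problem :: "('a, 'm) monoid_scheme \<Rightarrow> 'a set \<Rightarrow> ('a list \<times> 'a list) set" where
  "word_problem G Y =
     {(u, v) \<in> nonempty_words Y \<times> nonempty_words Y. word_value G u = word_value G v}"

definition generalized_word_problem :: "('a, 'm) monoid_scheme \<Rightarrow> 'a set \<Rightarrow> 'a set \<Rightarrow> 'a list set" where
  "generalized_word_problem P U X = {w \<in> nonempty_words X. word_value P w \<in> U}"

text \<open>
  Decidability does not depend on the finite generating set (nor on the numbering of its letters),
  so it is stated for some finite generating set.
\<close>

definition word_problem_decidable :: "('a, 'm) monoid_scheme \<Rightarrow> bool" where
  "word_problem_decidable G \<longleftrightarrow>
     (\<exists>Y. finite Y \<and> generating_set G Y \<and> decidable_word_pairs Y (word_problem G Y))"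

definition generalized_word_problem_decidable :: "('a, 'm) monoid_scheme \<Rightarrow> 'a set \<Rightarrow> bool" where
  "generalized_word_problem_decidable P U \<longleftrightarrow>
     (\<exists>X. finite X \<and> generating_set P X \<and> decidable_words X (generalized_word_problem P U X))"

end

theory Submission
  imports Defs
begin

text \<open>
  Both directions are many-one reductions that translate words letter by letter.

  From the word problem of \<open>F\<close> to membership in the fiber product: a word over generators of
  \<open>S \<times>\<times> T\<close> has a value \<open>(s, t)\<close>, and replacing each generator \<open>x\<close> by words over the generators of
  \<open>F\<close> for \<open>\<phi> (fst x)\<close> and \<open>\<psi> (snd x)\<close> yields words for \<open>\<phi> s\<close> and \<open>\<psi> t\<close>.  The value is in the fiber
  product iff these two words agree in \<open>F\<close> (\<open>generalized_word_problem_decidable_if\<close>).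

  Conversely, to decide whether words \<open>u\<close> and \<open>v\<close> agree in \<open>F\<close>, one needs a word over generators of
  \<open>S \<times>\<times> T\<close> whose value \<open>(s, t)\<close> satisfies \<open>\<phi> s = u\<close> and \<open>\<psi> t = v\<close> in \<open>F\<close>.  If \<open>u\<close> and \<open>v\<close> have the same
  length, such a word arises from lifting the pairs of corresponding letters.  In the absence of
  identities, different lengths are a genuine obstacle; the finite generation of \<open>S \<times>\<times> T\<close> removes it.  Either \<open>F\<close> is finite, and its word problem is decided by its multiplication
  table (\<open>word_problem_decidable_if_finite\<close>).  Or \<open>F\<close> is infinite; then \<open>T\<close> is infinite, and an
  element \<open>\<phi> s\<close> of \<open>F\<close> that is not a product would make every pair \<open>(s, t)\<close> indecomposable, hence a
  member of each generating set of \<open>S \<times>\<times> T\<close>.  So every element of \<open>F\<close> is a product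
  (\<open>product_decomposition_if_product_finitely_generated\<close>), and \<open>F\<close> has a finite generating set in which
  every letter is a product of two letters (\<open>generating_set_splitting\<close>).  Over these generators, words
  can be lengthened by one letter at a time without changing their values, so that \<open>u\<close> and \<open>v\<close> can be
  brought to the same length (\<open>word_problem_decidable_if\<close>).

  That the translations are computable rests on the closure properties of the recursive functions in
  the first two sections: folds over coded lists (\<open>computable_fold\<close>) and lookup in finite tables
  (\<open>computable_table\<close>).
\<close>


section \<open>Computable functions on numbers\<close>

text \<open>
  Only unary functions are treated as computable objects; further arguments and the states of
  iterations are packed into one number with \<open>prod_encode\<close>.  Closure under composition, pairing,
  branching and iteration then suffices for all programs below, and recursive function terms occur
  only in the proofs of these closure properties.
\<close>

definition computable :: "(nat \<Rightarrow> nat) \<Rightarrow> bool" where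
  "computable f \<longleftrightarrow> (\<exists>r. \<forall>n. rec_eval r [n] (f n))"

text \<open>
  As equivalences, the rules of \<open>rec_eval\<close> let the simplifier run a term on given arguments, the
  intermediate values being found as witnesses.
\<close>

lemma rec_eval_Zero_iff: "rec_eval Zero xs y \<longleftrightarrow> y = 0"
  by (auto intro: rec_eval.Zero elim: rec_eval_ZeroE)

lemma rec_eval_Succ_iff: "rec_eval Succ [x] y \<longleftrightarrow> y = Suc x"
  by (auto intro: rec_eval.Succ elim: rec_eval_SuccE)

lemma rec_eval_Proj_iff: "rec_eval (Proj i) xs y \<longleftrightarrow> i < length xs \<and> y = xs ! i"
  by (auto intro: rec_eval.Proj elim: rec_eval_ProjE)

lemma rec_eval_Comp_iff:
  "rec_eval (Comp f gs) xs z \<longleftrightarrow> (\<exists>ys. list_all2 (\<lambda>g. rec_eval g xs) gs ys \<and> rec_eval f ys z)"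
  by (blast intro: rec_eval.Comp elim: rec_eval_CompE)

lemma rec_eval_Prim_0_iff: "rec_eval (Prim f g) (0 # xs) y \<longleftrightarrow> rec_eval f xs y"
  by (blast intro: rec_eval.Prim_0 elim: rec_eval_Prim_0E)

lemma rec_eval_Prim_Suc_iff:
  "rec_eval (Prim f g) (Suc n # xs) y \<longleftrightarrow>
     (\<exists>r. rec_eval (Prim f g) (n # xs) r \<and> rec_eval g (n # r # xs) y)"
  by (blast intro: rec_eval.Prim_Suc elim: rec_eval_Prim_SucE)

lemmas rec_eval_iffs =
  rec_eval_Zero_iff rec_eval_Succ_iff rec_eval_Proj_iff rec_eval_Comp_iff
  rec_eval_Prim_0_iff rec_eval_Prim_Suc_iff list_all2_Cons1

lemma computable_comp:
  assumes "computable f" "computable g"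
  shows "computable (\<lambda>x. f (g x))"
proof -
  from assms obtain r q where "\<And>n. rec_eval r [n] (f n)" "\<And>n. rec_eval q [n] (g n)"
    unfolding computable_def by blast
  then have "rec_eval (Comp r [q]) [n] (f (g n))" for n
    by (auto simp: rec_eval_iffs)
  then show ?thesis unfolding computable_def by blast
qed

lemma computable_binary:
  assumes "\<And>m n. rec_eval r [m, n] (h m n)" "computable f" "computable g"
  shows "computable (\<lambda>x. h (f x) (g x))"
proof -
  from assms obtain q s where "\<And>n. rec_eval q [n] (f n)" "\<And>n. rec_eval s [n] (g n)"
    unfolding computable_def by blast
  with assms(1) have "rec_eval (Comp r [q, s]) [n] (h (f n) (g n))" for n
    by (fastforce simp: rec_eval_iffs)
  then show ?thesis unfolding computable_def by blast
qed

lemma computable_id: "computable (\<lambda>x. x)"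
  unfolding computable_def by (rule exI[of _ "Proj 0"]) (simp add: rec_eval_iffs)

lemma computable_Suc: "computable f \<Longrightarrow> computable (\<lambda>x. Suc (f x))"
  by (rule computable_comp[of Suc]) (auto simp: computable_def intro: rec_eval.Succ)

lemma computable_const: "computable (\<lambda>x. c)"
proof (induction c)
  case 0
  show ?case unfolding computable_def using rec_eval.Zero by blast
next
  case (Suc c)
  then show ?case by (rule computable_Suc)
qed

lemma computable_If_0:
  assumes "computable c" "computable f" "computable g"
  shows "computable (\<lambda>x. if c x = 0 then f x else g x)"
proof -
  from assms obtain p q s where
    "\<And>n. rec_eval p [n] (c n)" "\<And>n. rec_eval q [n] (f n)" "\<And>n. rec_eval s [n] (g n)"
    unfolding computable_def by blast
  moreover have "rec_eval (Prim (Proj 0) (Proj 3)) [n, a, b] (if n = 0 then a else b)" for n a b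
    by (induction n) (auto simp: rec_eval_iffs)
  ultimately have "rec_eval (Comp (Prim (Proj 0) (Proj 3)) [p, q, s]) [n] (if c n = 0 then f n else g n)"
    for n
    unfolding rec_eval_Comp_iff by (intro exI[of _ "[c n, f n, g n]"]) simp
  then show ?thesis unfolding computable_def by blast
qed

lemma computable_funpow:
  assumes "computable f" "computable k" "computable g"
  shows "computable (\<lambda>x. (f ^^ k x) (g x))"
proof -
  from assms(1) obtain r where r: "\<And>n. rec_eval r [n] (f n)"
    unfolding computable_def by blast
  have "rec_eval (Prim (Proj 0) (Comp r [Proj 1])) [n, a] ((f ^^ n) a)" for n a
  proof (induction n)
    case (Suc n)
    with r[of "(f ^^ n) a"] show ?case by (force simp: rec_eval_iffs)
  qed (simp add: rec_eval_iffs)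
  then show ?thesis by (rule computable_binary) fact+
qed

definition rec_pred :: recf where "rec_pred = Prim Zero (Proj 0)"

definition rec_minus :: recf where "rec_minus = Prim (Proj 0) (Comp rec_pred [Proj 1])"

definition rec_add :: recf where "rec_add = Prim (Proj 0) (Comp Succ [Proj 1])"

definition rec_triangle :: recf where
  "rec_triangle = Prim Zero (Comp rec_add [Comp Succ [Proj 0], Proj 1])"

definition rec_triangle_root :: recf where
  "rec_triangle_root =
     Minim (Comp rec_minus [Comp rec_triangle [Comp Succ [Proj 0]], Comp Succ [Proj 1]])"

lemma rec_eval_pred: "rec_eval rec_pred [n] (n - 1)"
  unfolding rec_pred_def by (induction n) (auto simp: rec_eval_iffs)

lemma rec_eval_minus: "rec_eval rec_minus [m, n] (n - m)"
  unfolding rec_minus_def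
proof (induction m)
  case (Suc m)
  with rec_eval_pred[of "n - m"] show ?case by (force simp: rec_eval_iffs)
qed (simp add: rec_eval_iffs)

lemma rec_eval_add: "rec_eval rec_add [m, n] (m + n)"
  unfolding rec_add_def by (induction m) (auto simp: rec_eval_iffs)

lemma rec_eval_triangle: "rec_eval rec_triangle [n] (triangle n)"
  unfolding rec_triangle_def
proof (induction n)
  case (Suc n)
  with rec_eval_add[of "Suc n" "triangle n"] show ?case by (force simp: rec_eval_iffs add.commute)
qed (simp add: rec_eval_iffs)

text \<open>
  The root \<open>k\<close> of \<open>n\<close>, for which \<open>triangle k \<le> n < triangle (Suc k)\<close>, is the least \<open>k\<close> at which
  the truncated difference \<open>Suc n - triangle (Suc k)\<close> vanishes.
\<close>

lemma rec_eval_triangle_root: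
  assumes "m \<le> k"
  shows "rec_eval rec_triangle_root [triangle k + m] k"
  unfolding rec_triangle_root_def
proof (rule rec_eval.Minim)
  let ?n = "triangle k + m"
  let ?f = "Comp rec_minus [Comp rec_triangle [Comp Succ [Proj 0]], Comp Succ [Proj 1]]"
  have eval: "rec_eval ?f [j, ?n] (Suc ?n - triangle (Suc j))" for j
    using rec_eval_minus[of "triangle (Suc j)" "Suc ?n"] rec_eval_triangle[of "Suc j"]
    by (auto simp: rec_eval_iffs simp del: triangle_Suc)
  show "rec_eval ?f [k, ?n] 0"
    using eval[of k] assms by simp
  have mono: "triangle i \<le> triangle j" if "i \<le> j" for i j
    using that by (induction j rule: dec_induct) auto
  show "\<forall>j<k. \<exists>i. rec_eval ?f [j, ?n] (Suc i)"
  proof (intro allI impI)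
    fix j assume "j < k"
    then have "triangle (Suc j) \<le> triangle k" by (intro mono) simp
    then have "Suc ?n - triangle (Suc j) = Suc (?n - triangle (Suc j))" by linarith
    with eval[of j] show "\<exists>i. rec_eval ?f [j, ?n] (Suc i)" by metis
  qed
qed

lemma computable_minus: "computable f \<Longrightarrow> computable g \<Longrightarrow> computable (\<lambda>x. f x - g x)"
  by (rule computable_binary[of rec_minus "\<lambda>m n. n - m"]) (auto intro: rec_eval_minus)

lemma computable_add: "computable f \<Longrightarrow> computable g \<Longrightarrow> computable (\<lambda>x. f x + g x)"
  by (rule computable_binary[of rec_add]) (auto intro: rec_eval_add)

lemma computable_triangle: "computable f \<Longrightarrow> computable (\<lambda>x. triangle (f x))"
  by (rule computable_comp[of triangle]) (use rec_eval_triangle in \<open>auto simp: computable_def\<close>)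

lemma computable_prod_encode:
  "computable f \<Longrightarrow> computable g \<Longrightarrow> computable (\<lambda>x. prod_encode (f x, g x))"
  unfolding prod_encode_def by (auto intro!: computable_add computable_triangle)

text \<open>
  The pairs are numbered diagonal by diagonal, those with sum \<open>k\<close> from \<open>triangle k\<close> on.  So the sum
  of a decoded pair is the triangular root of its code, and the first component is the offset.
\<close>

lemma triangle_prod_decode:
  "triangle (fst (prod_decode x) + snd (prod_decode x)) + fst (prod_decode x) = x"
  using prod_decode_inverse[of x]
  by (cases "prod_decode x") (simp add: prod_encode_def)

lemma computable_prod_decode_sum:
  "computable (\<lambda>x. fst (prod_decode x) + snd (prod_decode x))"
  unfolding computable_def
proof (intro exI allI)
  fix x
  show "rec_eval rec_triangle_root [x] (fst (prod_decode x) + snd (prod_decode x))"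
    using rec_eval_triangle_root[of "fst (prod_decode x)" "fst (prod_decode x) + snd (prod_decode x)"]
    by (simp add: triangle_prod_decode)
qed

lemma computable_fst_prod_decode:
  assumes "computable f"
  shows "computable (\<lambda>x. fst (prod_decode (f x)))"
proof (rule computable_comp[of "\<lambda>x. fst (prod_decode x)", OF _ assms])
  have "x - triangle (fst (prod_decode x) + snd (prod_decode x)) = fst (prod_decode x)" for x
    using triangle_prod_decode[of x] by linarith
  then show "computable (\<lambda>x. fst (prod_decode x))"
    using computable_minus[OF computable_id computable_triangle[OF computable_prod_decode_sum]]
    by (simp only:)
qed

lemma computable_snd_prod_decode:
  assumes "computable f"
  shows "computable (\<lambda>x. snd (prod_decode (f x)))"
proof (rule computable_comp[of "\<lambda>x. snd (prod_decode x)", OF _ assms])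
  show "computable (\<lambda>x. snd (prod_decode x))"
    using computable_minus[OF computable_prod_decode_sum
        computable_fst_prod_decode[OF computable_id]] by simp
qed

lemmas computable_intros =
  computable_id computable_const computable_Suc computable_minus computable_add
  computable_prod_encode computable_fst_prod_decode computable_snd_prod_decode computable_If_0

lemma computable_curry:
  assumes "computable (\<lambda>p. h (fst (prod_decode p)) (snd (prod_decode p)))"
    and "computable f" "computable g"
  shows "computable (\<lambda>x. h (f x) (g x))"
  using computable_comp[OF assms(1) computable_prod_encode[OF assms(2,3)]] by simp

lemma computable_If_eq:
  assumes "computable f" "computable g" "computable h" "computable k"
  shows "computable (\<lambda>x. if f x = g x then h x else k x)"
proof -
  have "computable (\<lambda>x. if (f x - g x) + (g x - f x) = 0 then h x else k x)"
    by (intro computable_intros assms)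
  moreover have "(f x - g x) + (g x - f x) = 0 \<longleftrightarrow> f x = g x" for x by arith
  ultimately show ?thesis by simp
qed

text \<open>
  Every finite amount of information about semigroups or letters enters a program through such a
  table: generators written as words, factorizations of letters, a finite multiplication table.
\<close>

lemma computable_table:
  assumes "finite A" "inj_on c A"
  obtains t where "computable t" "\<And>a. a \<in> A \<Longrightarrow> t (c a) = g a"
proof -
  from assms have "\<exists>t. computable t \<and> (\<forall>a\<in>A. t (c a) = g a)"
  proof (induction A)
    case empty
    show ?case using computable_id by auto
  next
    case (insert b A)
    then obtain t where t: "computable t" "\<forall>a\<in>A. t (c a) = g a" by auto
    let ?t = "\<lambda>n. if n = c b then g b else t n"
    have "computable ?t" by (intro computable_If_eq computable_intros t)
    moreover have "\<forall>a\<in>insert b A. ?t (c a) = g a"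
      using t(2) insert.prems insert.hyps by (auto simp: inj_on_def)
    ultimately show ?case by blast
  qed
  with that show thesis by blast
qed


section \<open>Computing with codes of lists\<close>

lemma length_le_list_encode: "length xs \<le> list_encode xs"
proof (induction xs)
  case (Cons x xs)
  then show ?case using le_prod_encode_2[of "list_encode xs" x] by simp
qed simp

text \<open>
  The loop over a list iterates a state consisting of the remaining list and the accumulator.
  Iterating as often as the code of the list says is enough, since the code bounds the length and
  an exhausted list leaves the state unchanged.
\<close>

lemma computable_fold:
  assumes step: "computable (\<lambda>p. f (fst (prod_decode p)) (snd (prod_decode p)))"
    and l: "computable l" and i: "computable i"
  shows "computable (\<lambda>x. fold f (list_decode (l x)) (i x))"
proof -
  define next_state where "next_state s =
    (if fst (prod_decode s) = 0 then s
     else prod_encode (snd (prod_decode (fst (prod_decode s) - 1)),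
       f (fst (prod_decode (fst (prod_decode s) - 1))) (snd (prod_decode s))))" for s
  have next_state: "computable next_state"
    unfolding next_state_def by (intro computable_curry[OF step] computable_intros)
  have run: "(next_state ^^ k) (prod_encode (list_encode xs, a)) = prod_encode (0, fold f xs a)"
    if "length xs \<le> k" for k xs a
    using that
  proof (induction k arbitrary: xs a)
    case 0
    then show ?case by simp
  next
    case (Suc k)
    show ?case
    proof (cases xs)
      case Nil
      with Suc.IH[of "[]" a] show ?thesis
        by (simp add: funpow_swap1 next_state_def)
    next
      case (Cons y ys)
      have "next_state (prod_encode (list_encode xs, a)) = prod_encode (list_encode ys, f y a)"
        using Cons by (simp add: next_state_def)
      with Suc.IH[of ys "f y a"] Suc.prems Cons show ?thesis
        by (simp add: funpow_swap1)
    qed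
  qed
  have "(next_state ^^ l x) (prod_encode (l x, i x)) = prod_encode (0, fold f (list_decode (l x)) (i x))"
    for x
    using run[of "list_decode (l x)" "l x" "i x"] length_le_list_encode[of "list_decode (l x)"]
    by simp
  then have "fold f (list_decode (l x)) (i x)
      = snd (prod_decode ((next_state ^^ l x) (prod_encode (l x, i x))))" for x
    by simp
  then show ?thesis
    by (simp only:) (intro computable_intros computable_funpow next_state l i)
qed

definition cons_code :: "nat \<Rightarrow> nat \<Rightarrow> nat" where
  "cons_code a n = Suc (prod_encode (a, n))"

definition hd_code :: "nat \<Rightarrow> nat" where
  "hd_code n = fst (prod_decode (n - 1))"

definition tl_code :: "nat \<Rightarrow> nat" where
  "tl_code n = snd (prod_decode (n - 1))"

lemma cons_code: "cons_code a (list_encode xs) = list_encode (a # xs)"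
  by (simp add: cons_code_def)

lemma hd_code: "hd_code (list_encode (a # xs)) = a"
  by (simp add: hd_code_def)

lemma tl_code: "tl_code (list_encode (a # xs)) = list_encode xs"
  by (simp add: tl_code_def)

definition rev_code :: "nat \<Rightarrow> nat" where
  "rev_code n = fold cons_code (list_decode n) 0"

text \<open>
  Folding consumes a list from the left while \<open>cons_code\<close> builds one from the right, so a list that
  is to be copied in its order is reversed first.  Substitutions do the same.
\<close>

definition append_code :: "nat \<Rightarrow> nat \<Rightarrow> nat" where
  "append_code m n = fold cons_code (list_decode (rev_code m)) n"

lemma fold_cons_code: "fold cons_code xs (list_encode ys) = list_encode (rev xs @ ys)"
  by (induction xs arbitrary: ys) (simp_all add: cons_code del: list_encode.simps(2))

lemma rev_code: "rev_code (list_encode xs) = list_encode (rev xs)"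
  using fold_cons_code[of xs "[]"] by (simp add: rev_code_def)

lemma append_code: "append_code (list_encode xs) (list_encode ys) = list_encode (xs @ ys)"
  by (simp add: append_code_def rev_code fold_cons_code)

lemma computable_cons_code:
  "computable f \<Longrightarrow> computable g \<Longrightarrow> computable (\<lambda>x. cons_code (f x) (g x))"
  unfolding cons_code_def by (intro computable_intros)

lemma computable_hd_code: "computable f \<Longrightarrow> computable (\<lambda>x. hd_code (f x))"
  unfolding hd_code_def by (intro computable_intros)

lemma computable_tl_code: "computable f \<Longrightarrow> computable (\<lambda>x. tl_code (f x))"
  unfolding tl_code_def by (intro computable_intros)

lemma computable_rev_code: "computable f \<Longrightarrow> computable (\<lambda>x. rev_code (f x))"
  unfolding rev_code_def by (intro computable_fold computable_cons_code computable_intros)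

lemma computable_append_code:
  "computable f \<Longrightarrow> computable g \<Longrightarrow> computable (\<lambda>x. append_code (f x) (g x))"
  unfolding append_code_def
  by (intro computable_fold computable_cons_code computable_rev_code computable_intros)

lemmas computable_list_intros =
  computable_cons_code computable_hd_code computable_tl_code computable_rev_code
  computable_append_code computable_intros

section \<open>Decidable sets of numbers\<close>

lemma decidable_set_iff_computable:
  "decidable_set A \<longleftrightarrow> computable (\<lambda>n. if n \<in> A then 1 else 0)"
  unfolding decidable_set_def computable_def by simp

lemma decidable_set_vimage:
  assumes "decidable_set A" "computable f"
  shows "decidable_set {n. f n \<in> A}"
  using computable_comp[OF assms(1)[unfolded decidable_set_iff_computable] assms(2)]
  unfolding decidable_set_iff_computable by simp

lemma decidable_set_conj:
  assumes "decidable_set {n. P n}" "decidable_set {n. Q n}"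
  shows "decidable_set {n. P n \<and> Q n}"
proof -
  have "computable (\<lambda>n. if (if n \<in> {n. P n} then 1 else 0) = (0::nat) then 0
      else if n \<in> {n. Q n} then 1 else 0)"
    using assms unfolding decidable_set_iff_computable by (intro computable_If_0 computable_const)
  moreover have "(\<lambda>n. if (if n \<in> {n. P n} then 1 else 0) = (0::nat) then 0
      else if n \<in> {n. Q n} then 1 else 0) = (\<lambda>n. if n \<in> {n. P n \<and> Q n} then 1 else (0::nat))"
    by auto
  ultimately show ?thesis unfolding decidable_set_iff_computable by simp
qed

lemma decidable_set_eq:
  assumes "computable f" "computable g"
  shows "decidable_set {n. f n = g n}"
  using computable_If_eq[OF assms computable_const computable_const]
  unfolding decidable_set_iff_computable by simp


section \<open>Products of words in semigroups\<close>

lemma nonempty_words_append: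
  "u \<in> nonempty_words X \<Longrightarrow> v \<in> nonempty_words X \<Longrightarrow> u @ v \<in> nonempty_words X"
  by (auto simp: nonempty_words_def)

lemma nonempty_words_Cons:
  "a # w \<in> nonempty_words X \<longleftrightarrow> a \<in> X \<and> (w = [] \<or> w \<in> nonempty_words X)"
  by (auto simp: nonempty_words_def)

lemma nonempty_words_mono: "X \<subseteq> X' \<Longrightarrow> w \<in> nonempty_words X \<Longrightarrow> w \<in> nonempty_words X'"
  by (auto simp: nonempty_words_def)

lemma nonempty_words_map:
  "w \<in> nonempty_words X \<Longrightarrow> (\<And>x. x \<in> X \<Longrightarrow> f x \<in> Y) \<Longrightarrow> map f w \<in> nonempty_words Y"
  by (auto simp: nonempty_words_def)

lemma nonempty_words_induct [consumes 1, case_names single Cons]: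
  assumes "w \<in> nonempty_words X"
    and "\<And>x. x \<in> X \<Longrightarrow> P [x]"
    and "\<And>x w. x \<in> X \<Longrightarrow> w \<in> nonempty_words X \<Longrightarrow> P w \<Longrightarrow> P (x # w)"
  shows "P w"
  using assms(1)
proof (induction w)
  case (Cons x w)
  then show ?case using assms(2,3) by (auto simp: nonempty_words_Cons)
qed (simp add: nonempty_words_def)

lemma nonempty_words_concat_map:
  assumes "w \<in> nonempty_words X" "\<And>x. x \<in> X \<Longrightarrow> h x \<in> nonempty_words Y"
  shows "concat (map h w) \<in> nonempty_words Y"
  using assms(1) by (induction rule: nonempty_words_induct)
    (use assms(2) in \<open>auto intro: nonempty_words_append\<close>)

lemma word_value_Cons:
  "w \<noteq> [] \<Longrightarrow> word_value G (x # w) = x \<otimes>\<^bsub>G\<^esub> word_value G w"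
  by (cases w) auto

lemma nonempty_wordsD: "w \<in> nonempty_words X \<Longrightarrow> w \<noteq> []"
  by (simp add: nonempty_words_def)

context alg_semigroup
begin

lemma word_value_closed: "w \<in> nonempty_words (carrier G) \<Longrightarrow> word_value G w \<in> carrier G"
  by (induction rule: nonempty_words_induct)
    (auto simp: word_value_Cons m_closed dest: nonempty_wordsD)

lemma word_value_append:
  assumes "u \<in> nonempty_words (carrier G)" "v \<in> nonempty_words (carrier G)"
  shows "word_value G (u @ v) = word_value G u \<otimes> word_value G v"
  using assms(1)
proof (induction rule: nonempty_words_induct)
  case (single x)
  show ?case using nonempty_wordsD[OF assms(2)] by (simp add: word_value_Cons)
next
  case (Cons x w)
  then show ?case using nonempty_wordsD[OF Cons(2)] assms(2)
    by (simp add: word_value_Cons m_assoc word_value_closed)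
qed

lemma word_value_concat_map:
  assumes "w \<in> nonempty_words X" "\<And>x. x \<in> X \<Longrightarrow> h x \<in> nonempty_words (carrier G)"
  shows "word_value G (concat (map h w)) = word_value G (map (\<lambda>x. word_value G (h x)) w)"
  using assms(1)
proof (induction rule: nonempty_words_induct)
  case (single x)
  show ?case by simp
next
  case (Cons x w)
  have "concat (map h w) \<in> nonempty_words (carrier G)"
    using Cons(2) assms(2) by (rule nonempty_words_concat_map)
  then show ?case using Cons nonempty_wordsD[OF Cons(2)] assms(2)[OF Cons(1)]
    by (simp add: word_value_append word_value_Cons)
qed

end

lemma word_value_map_hom:
  assumes "alg_semigroup G" "f \<in> hom G H" "w \<in> nonempty_words (carrier G)"
  shows "word_value H (map f w) = f (word_value G w)"
  using assms(3)
proof (induction rule: nonempty_words_induct)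
  case (Cons x w)
  then show ?case using nonempty_wordsD[OF Cons(2)] assms(2)
      alg_semigroup.word_value_closed[OF assms(1) Cons(2)]
    by (simp add: word_value_Cons hom_def)
qed simp

lemma alg_semigroup_DirProd:
  assumes "alg_semigroup G" "alg_semigroup H"
  shows "alg_semigroup (G \<times>\<times> H)"
proof -
  interpret G: alg_semigroup G by fact
  interpret H: alg_semigroup H by fact
  show ?thesis
    by unfold_locales (auto simp: G.m_closed G.m_assoc H.m_closed H.m_assoc)
qed

lemma generating_set_choose:
  assumes "generating_set G X"
  obtains h where "\<And>a. a \<in> carrier G \<Longrightarrow> h a \<in> nonempty_words X"
    "\<And>a. a \<in> carrier G \<Longrightarrow> word_value G (h a) = a"
proof -
  have "\<forall>a\<in>carrier G. \<exists>w. w \<in> nonempty_words X \<and> word_value G w = a"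
    using assms unfolding generating_set_def by auto
  then show thesis using that by metis
qed

lemma generating_set_hom_image:
  assumes "alg_semigroup G" "f \<in> hom G H" "f ` carrier G = carrier H" "generating_set G X"
  shows "generating_set H (f ` X)"
proof -
  from assms(4) have X: "X \<subseteq> carrier G" "carrier G = word_value G ` nonempty_words X"
    by (auto simp: generating_set_def)
  have "nonempty_words (f ` X) = map f ` nonempty_words X"
    by (auto simp: nonempty_words_def lists_image)
  then have "word_value H ` nonempty_words (f ` X) = (\<lambda>w. word_value H (map f w)) ` nonempty_words X"
    by (simp add: image_image)
  also have "\<dots> = (\<lambda>w. f (word_value G w)) ` nonempty_words X"
    using word_value_map_hom[OF assms(1,2)] X(1) nonempty_words_mono by (metis (no_types, lifting) image_cong)
  also have "\<dots> = carrier H"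
    using X(2) assms(3) by (metis image_image)
  finally show ?thesis using X(1) assms(3) by (auto simp: generating_set_def subset_iff)
qed

text \<open>
  Choosing the letters of the words so that each is a product of two letters makes it possible to
  lengthen a word by exactly one letter.  If every letter of \<open>X\<close> is a product of at least two
  letters, it suffices to add the values of all proper suffixes of these factorizations: a suffix
  of length at least two is its first letter times the next suffix.
\<close>

lemma generating_set_splitting:
  fixes G (structure)
  assumes G: "alg_semigroup G" and X: "finite X" "generating_set G X"
    and square: "\<And>a. a \<in> carrier G \<Longrightarrow> \<exists>b\<in>carrier G. \<exists>c\<in>carrier G. a = b \<otimes> c"
  obtains Y p q where "finite Y" "generating_set G Y" "\<And>y. y \<in> Y \<Longrightarrow> p y \<in> Y"
    "\<And>y. y \<in> Y \<Longrightarrow> q y \<in> Y" "\<And>y. y \<in> Y \<Longrightarrow> y = p y \<otimes>\<^bsub>G\<^esub> q y"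
proof -
  interpret alg_semigroup G by fact
  have XG: "X \<subseteq> carrier G" and onto: "carrier G = word_value G ` nonempty_words X"
    using X(2) by (auto simp: generating_set_def)
  obtain h where h: "\<And>a. a \<in> carrier G \<Longrightarrow> h a \<in> nonempty_words X"
    "\<And>a. a \<in> carrier G \<Longrightarrow> word_value G (h a) = a"
    using generating_set_choose[OF X(2)] by blast
  have "\<exists>x v. x \<in> X \<and> v \<in> nonempty_words X \<and> word_value G (x # v) = a" if a: "a \<in> carrier G" for a
  proof -
    from square[OF a] obtain b c where bc: "b \<in> carrier G" "c \<in> carrier G" "a = b \<otimes>\<^bsub>G\<^esub> c" by blast
    obtain x w where w: "h b = x # w" using nonempty_wordsD[OF h(1)[OF bc(1)]] by (cases "h b") auto
    have "word_value G (h b @ h c) = a"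
      using word_value_append[of "h b" "h c"] h bc nonempty_words_mono[OF XG] by simp
    moreover have "x \<in> X" using h(1)[OF bc(1)] w by (simp add: nonempty_words_Cons)
    moreover have "w @ h c \<in> nonempty_words X"
      using h(1)[OF bc(1)] h(1)[OF bc(2)] w by (auto simp: nonempty_words_def)
    ultimately show ?thesis using w by (intro exI[of _ x] exI[of _ "w @ h c"]) simp
  qed
  then obtain d r where d: "\<And>a. a \<in> carrier G \<Longrightarrow> d a \<in> X"
      "\<And>a. a \<in> carrier G \<Longrightarrow> r a \<in> nonempty_words X"
      "\<And>a. a \<in> carrier G \<Longrightarrow> word_value G (d a # r a) = a"
    by metis
  define Y where "Y = X \<union> (\<Union>x\<in>X. word_value G ` (\<lambda>n. drop n (r x)) ` {..<length (r x)})"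
  have finite: "finite Y" using X(1) by (auto simp: Y_def)
  have drop: "drop n (r x) \<in> nonempty_words X" if "x \<in> X" "n < length (r x)" for x n
    using d(2)[of x] that XG by (auto simp: nonempty_words_def dest: in_set_dropD)
  have YG: "Y \<subseteq> carrier G"
    using XG drop word_value_closed nonempty_words_mono[OF XG] by (auto simp: Y_def)
  have "word_value G ` nonempty_words Y \<subseteq> carrier G"
    using word_value_closed nonempty_words_mono[OF YG] by auto
  moreover have "nonempty_words X \<subseteq> nonempty_words Y"
    using nonempty_words_mono[of X Y] by (auto simp: Y_def)
  ultimately have gen: "generating_set G Y"
    using YG onto by (auto simp: generating_set_def)
  have "\<exists>b\<in>Y. \<exists>c\<in>Y. y = b \<otimes> c" if "y \<in> Y" for y
  proof -
    have letter: "\<exists>b\<in>Y. \<exists>c\<in>Y. x = b \<otimes> c" if "x \<in> X" for x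
    proof (intro bexI)
      have x: "x \<in> carrier G" using that XG by auto
      have "r x \<noteq> []" using nonempty_wordsD[OF d(2)[OF x]] .
      then show "x = d x \<otimes> word_value G (r x)" using d(3)[OF x] by (simp add: word_value_Cons)
      show "d x \<in> Y" using d(1)[OF x] by (simp add: Y_def)
      have "word_value G (drop 0 (r x)) \<in> Y"
        using that \<open>r x \<noteq> []\<close> unfolding Y_def by blast
      then show "word_value G (r x) \<in> Y" by simp
    qed
    show ?thesis
    proof (cases "y \<in> X")
      case True
      then show ?thesis by (rule letter)
    next
      case False
      then obtain x n where xn: "x \<in> X" "n < length (r x)" "y = word_value G (drop n (r x))"
        using \<open>y \<in> Y\<close> by (auto simp: Y_def)
      have eq: "drop n (r x) = r x ! n # drop (Suc n) (r x)" using xn(2) by (simp add: Cons_nth_drop_Suc)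
      have mem: "r x ! n \<in> X" using drop[OF xn(1,2)] unfolding eq by (simp add: nonempty_words_Cons)
      show ?thesis
      proof (cases "Suc n < length (r x)")
        case True
        then have "word_value G (drop (Suc n) (r x)) \<in> Y" using xn(1) unfolding Y_def by blast
        moreover have "y = r x ! n \<otimes> word_value G (drop (Suc n) (r x))"
          using xn(3) eq True by (simp add: word_value_Cons)
        ultimately show ?thesis using mem unfolding Y_def by blast
      next
        case False
        then have "y = r x ! n" using xn(3) eq by simp
        then show ?thesis using letter mem by blast
      qed
    qed
  qed
  then obtain p q where "\<And>y. y \<in> Y \<Longrightarrow> p y \<in> Y" "\<And>y. y \<in> Y \<Longrightarrow> q y \<in> Y"
      "\<And>y. y \<in> Y \<Longrightarrow> y = p y \<otimes>\<^bsub>G\<^esub> q y"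
    by metis
  with finite gen show thesis by (rule that)
qed

text \<open>
  Write \<open>a = \<phi> s\<close>.  Infinitely many elements of \<open>T\<close> are available, as \<open>T\<close> maps onto the infinite
  \<open>F\<close>, so some \<open>t\<close> is not the second component of a generator of \<open>S \<times>\<times> T\<close>.  Then \<open>(s, t)\<close> is no
  generator, hence a product of two elements, and \<open>\<phi> \<circ> fst\<close> maps this factorization to one of \<open>a\<close>.
\<close>

lemma product_decomposition_if_product_finitely_generated:
  assumes S: "alg_semigroup S" and T: "alg_semigroup T" and fg: "finitely_generated (S \<times>\<times> T)"
    and \<phi>: "\<phi> \<in> hom S F" "\<phi> ` carrier S = carrier F"
    and \<psi>: "\<psi> ` carrier T = carrier F"
    and infinite: "infinite (carrier F)" and a: "a \<in> carrier F"
  shows "\<exists>b\<in>carrier F. \<exists>c\<in>carrier F. a = b \<otimes>\<^bsub>F\<^esub> c"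
proof -
  interpret P: alg_semigroup "S \<times>\<times> T" using S T by (rule alg_semigroup_DirProd)
  from fg obtain X where X: "finite X" "X \<subseteq> carrier (S \<times>\<times> T)"
    "carrier (S \<times>\<times> T) = word_value (S \<times>\<times> T) ` nonempty_words X"
    unfolding finitely_generated_def generating_set_def by blast
  obtain s where s: "s \<in> carrier S" "\<phi> s = a" using \<phi>(2) a by (metis imageE)
  have "\<not> carrier T \<subseteq> snd ` X"
    using X(1) \<psi> infinite by (metis finite_imageI finite_subset)
  then obtain t where t: "t \<in> carrier T" "t \<notin> snd ` X" by auto
  then have "(s, t) \<in> carrier (S \<times>\<times> T)" using s by simp
  then obtain w where w: "w \<in> nonempty_words X" "word_value (S \<times>\<times> T) w = (s, t)"
    using X(3) by (metis imageE)
  obtain x v where v: "w = x # v" using nonempty_wordsD[OF w(1)] by (cases w) auto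
  have "v \<noteq> []"
    using w v t(2) by (auto simp: nonempty_words_Cons image_iff)
  then have mem: "x \<in> carrier (S \<times>\<times> T)" "word_value (S \<times>\<times> T) v \<in> carrier (S \<times>\<times> T)"
    and "(s, t) = x \<otimes>\<^bsub>S \<times>\<times> T\<^esub> word_value (S \<times>\<times> T) v"
    using w v X(2) P.word_value_closed[of v] nonempty_words_mono[OF X(2), of v]
    by (auto simp: nonempty_words_Cons word_value_Cons)
  then have "s = fst x \<otimes>\<^bsub>S\<^esub> fst (word_value (S \<times>\<times> T) v)"
    by (cases x, cases "word_value (S \<times>\<times> T) v") simp
  then have "a = \<phi> (fst x) \<otimes>\<^bsub>F\<^esub> \<phi> (fst (word_value (S \<times>\<times> T) v))"
    using \<phi>(1) s(2) mem by (auto simp: hom_def mem_Times_iff)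
  moreover have "\<phi> (fst x) \<in> carrier F" "\<phi> (fst (word_value (S \<times>\<times> T) v)) \<in> carrier F"
    using \<phi>(1) mem by (auto simp: hom_def mem_Times_iff)
  ultimately show ?thesis by blast
qed


section \<open>Computing with codes of words\<close>

lemma inj_on_to_nat_on_finite: "finite X \<Longrightarrow> inj_on (to_nat_on X) X"
  by (intro inj_on_to_nat_on countable_finite)

lemma inj_on_word_code:
  assumes "finite X"
  shows "inj_on (word_code X) (lists X)"
proof (rule inj_onI)
  fix u v assume "u \<in> lists X" "v \<in> lists X" "word_code X u = word_code X v"
  then have "map (to_nat_on X) u = map (to_nat_on X) v" "set u \<union> set v \<subseteq> X"
    by (auto simp: word_code_def list_encode_eq)
  then show "u = v"
    using inj_on_subset[OF inj_on_to_nat_on_finite[OF assms]] by (blast intro: map_inj_on)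
qed

lemma word_code_append: "word_code X (u @ v) = append_code (word_code X u) (word_code X v)"
  by (simp add: word_code_def append_code)

text \<open>
  A number is the code of a nonempty word over \<open>X\<close> iff it is not \<open>0\<close>, the code of the empty list,
  and all entries of the list that it encodes are below \<open>card X\<close>.  The proof adds up a count of the
  violations of these conditions.
\<close>

lemma decidable_nonempty_words:
  assumes "finite X"
  shows "decidable_set (word_code X ` nonempty_words X)"
proof -
  \<comment> \<open>\<open>1 - n\<close> is positive only for \<open>n = 0\<close>, and \<open>Suc a - card X\<close> only for entries outside the range.\<close>
  define bad where "bad n = fold (\<lambda>a b. (Suc a - card X) + b) (list_decode n) (1 - n)" for n
  have fold_eq: "fold (\<lambda>a b. (Suc a - card X) + b) xs b = 0 \<longleftrightarrow> b = 0 \<and> (\<forall>a\<in>set xs. a < card X)"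
    for xs b
    by (induction xs arbitrary: b) auto
  have range: "to_nat_on X ` X = {..<card X}"
    using to_nat_on_finite[OF assms] by (rule bij_betw_imp_surj_on)
  have "word_code X ` nonempty_words X = {n. bad n = 0}"
  proof (intro equalityI subsetI)
    fix n assume "n \<in> word_code X ` nonempty_words X"
    then obtain w where w: "w \<in> nonempty_words X" "n = word_code X w" by auto
    then have "n \<noteq> 0" by (cases w) (auto simp: word_code_def nonempty_words_def)
    moreover have "\<forall>a\<in>set (list_decode n). a < card X"
      using w range by (auto simp: word_code_def nonempty_words_def)
    ultimately show "n \<in> {n. bad n = 0}" by (simp add: bad_def fold_eq)
  next
    fix n assume "n \<in> {n. bad n = 0}"
    then have n: "n \<noteq> 0" "\<forall>a\<in>set (list_decode n). a \<in> to_nat_on X ` X"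
      by (auto simp: bad_def fold_eq range)
    let ?w = "map (from_nat_into X) (list_decode n)"
    have "map (to_nat_on X) ?w = list_decode n"
      using n(2) by (simp add: map_idI to_nat_on_from_nat_into)
    then have "word_code X ?w = n" by (simp add: word_code_def)
    moreover have "?w \<noteq> []" using n(1) by (metis list.map_disc_iff list_decode_inverse list_encode.simps(1))
    moreover have "?w \<in> lists X"
      using n(2) from_nat_into_to_nat_on[OF countable_finite[OF assms]] by (force simp: in_lists_conv_set)
    ultimately show "n \<in> word_code X ` nonempty_words X"
      unfolding nonempty_words_def by (metis (mono_tags, lifting) image_eqI mem_Collect_eq)
  qed
  moreover have "computable bad"
    unfolding bad_def[abs_def] by (intro computable_fold computable_intros)
  ultimately show ?thesis using decidable_set_eq[OF _ computable_const[of 0]] by simp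
qed

definition pair_code :: "'a set \<Rightarrow> 'a list \<times> 'a list \<Rightarrow> nat" where
  "pair_code X = (\<lambda>(u, v). prod_encode (word_code X u, word_code X v))"

lemma decidable_nonempty_word_pairs:
  assumes "finite X"
  shows "decidable_set (pair_code X ` (nonempty_words X \<times> nonempty_words X))"
proof -
  let ?W = "word_code X ` nonempty_words X"
  have "pair_code X ` (nonempty_words X \<times> nonempty_words X)
      = {n. fst (prod_decode n) \<in> ?W \<and> snd (prod_decode n) \<in> ?W}"
  proof (intro equalityI subsetI)
    fix n assume "n \<in> {n. fst (prod_decode n) \<in> ?W \<and> snd (prod_decode n) \<in> ?W}"
    then obtain u v where uv: "u \<in> nonempty_words X" "v \<in> nonempty_words X"
      "prod_decode n = (word_code X u, word_code X v)" by (auto simp: prod_eq_iff)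
    then have "n = pair_code X (u, v)"
      by (metis case_prod_conv pair_code_def prod_decode_inverse)
    with uv show "n \<in> pair_code X ` (nonempty_words X \<times> nonempty_words X)" by blast
  qed (auto simp: pair_code_def)
  then show ?thesis
    using decidable_nonempty_words[OF assms]
    by (auto intro!: decidable_set_conj decidable_set_vimage computable_intros)
qed

lemma inj_on_pair_code: "finite X \<Longrightarrow> inj_on (pair_code X) (lists X \<times> lists X)"
  using inj_on_word_code[of X] by (auto simp: inj_on_def pair_code_def)

text \<open>
  Many-one reduction between coded sets.  The code \<open>d\<close> must be injective on a set that contains
  both \<open>L\<close> and the translated inputs, so that membership of \<open>d (f x)\<close> among the codes of \<open>L\<close> says
  that \<open>f x\<close> itself belongs to \<open>L\<close>; numbers that encode nothing in \<open>D\<close> are rejected beforehand.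
\<close>

lemma decidable_set_reduction:
  assumes "decidable_set (c ` D)" "decidable_set (d ` L)" "inj_on d E" "L \<subseteq> E" "computable \<sigma>"
    and "\<And>x. x \<in> D \<Longrightarrow> f x \<in> E" "\<And>x. x \<in> D \<Longrightarrow> \<sigma> (c x) = d (f x)"
  shows "decidable_set (c ` {x \<in> D. f x \<in> L})"
proof -
  have "f x \<in> L" if "x \<in> D" "d (f x) \<in> d ` L" for x
    using that assms(3,4,6) by (auto dest: inj_onD)
  then have "c ` {x \<in> D. f x \<in> L} = {n. n \<in> c ` D \<and> \<sigma> n \<in> d ` L}"
    using assms(7) by (auto simp del: image_eqI) (metis (mono_tags, lifting) image_eqI mem_Collect_eq)
  then show ?thesis
    using assms(1,2,5) by (simp add: decidable_set_conj decidable_set_vimage)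
qed

lemma computable_substitution:
  assumes "finite X"
  obtains \<sigma> where "computable \<sigma>"
    "\<And>w. w \<in> lists X \<Longrightarrow> \<sigma> (word_code X w) = word_code Y (concat (map h w))"
proof -
  obtain t where t: "computable t" "\<And>x. x \<in> X \<Longrightarrow> t (to_nat_on X x) = word_code Y (h x)"
    using computable_table[OF assms inj_on_to_nat_on_finite[OF assms], of "\<lambda>x. word_code Y (h x)"]
    by blast
  define \<sigma> where "\<sigma> n = fold (\<lambda>a b. append_code (t a) b) (list_decode (rev_code n)) 0" for n
  have "computable \<sigma>"
    unfolding \<sigma>_def[abs_def]
    by (intro computable_fold computable_list_intros computable_comp[OF t(1)])
  moreover have "\<sigma> (word_code X w) = word_code Y (concat (map h w))" if "w \<in> lists X" for w
  proof -
    have "fold (\<lambda>a b. append_code (t a) b) (rev (map (to_nat_on X) w)) 0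
        = word_code Y (concat (map h w))"
      using that
      by (induction w) (simp_all add: t(2) word_code_append, simp add: word_code_def)
    then show ?thesis by (simp add: \<sigma>_def word_code_def rev_code)
  qed
  ultimately show thesis by (rule that)
qed

text \<open>
  The word \<open>u\<close> drives the loop, while the state carries the rest of \<open>v\<close> and the output so far.
\<close>

lemma computable_zip_substitution:
  assumes "finite X"
  obtains \<sigma> where "computable \<sigma>"
    "\<And>u v. u \<in> lists X \<Longrightarrow> v \<in> lists X \<Longrightarrow> length u = length v \<Longrightarrow>
      \<sigma> (pair_code X (u, v)) = word_code Y (concat (map h (zip u v)))"
proof -
  let ?c = "\<lambda>(x, y). prod_encode (to_nat_on X x, to_nat_on X y)"
  have "inj_on ?c (X \<times> X)"
    using inj_on_to_nat_on_finite[OF assms] by (auto simp: inj_on_def)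
  then obtain t where t: "computable t" "\<And>z. z \<in> X \<times> X \<Longrightarrow> t (?c z) = word_code Y (h z)"
    using computable_table[of "X \<times> X" ?c "\<lambda>z. word_code Y (h z)"] assms by blast
  define step where "step a s = prod_encode (tl_code (fst (prod_decode s)),
    append_code (snd (prod_decode s)) (t (prod_encode (a, hd_code (fst (prod_decode s))))))" for a s
  define \<sigma> where "\<sigma> n = snd (prod_decode (fold step (list_decode (fst (prod_decode n)))
    (prod_encode (snd (prod_decode n), 0))))" for n
  have "computable \<sigma>"
    unfolding \<sigma>_def[abs_def] step_def
    by (intro computable_list_intros computable_fold computable_comp[OF t(1)])
  moreover have "\<sigma> (pair_code X (u, v)) = word_code Y (concat (map h (zip u v)))"
    if "u \<in> lists X" "v \<in> lists X" "length u = length v" for u v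
  proof -
    have "fold step (map (to_nat_on X) u) (prod_encode (word_code X v, word_code Y w))
        = prod_encode (0, word_code Y (w @ concat (map h (zip u v))))" for w
      using that(3,1,2)
    proof (induction u v arbitrary: w rule: list_induct2)
      case Nil
      show ?case by (simp add: word_code_def)
    next
      case (Cons x u y v)
      have "step (to_nat_on X x) (prod_encode (word_code X (y # v), word_code Y w))
          = prod_encode (word_code X v, word_code Y (w @ h (x, y)))"
        using t(2)[of "(x, y)"] Cons.prems
        by (simp add: step_def word_code_append)
          (simp add: word_code_def hd_code tl_code del: list_encode.simps)
      with Cons show ?case by simp
    qed
    from this[of "[]"] show ?thesis by (simp add: \<sigma>_def pair_code_def) (simp add: word_code_def)
  qed
  ultimately show thesis by (rule that)
qed

text \<open>
  A finite semigroup is evaluated from right to left with its multiplication table.  The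
  accumulator \<open>0\<close> stands for the empty word, which has no value, so that values are shifted by one.
\<close>

lemma computable_word_value_finite:
  fixes G (structure)
  assumes "alg_semigroup G" "finite (carrier G)"
  obtains \<sigma> where "computable \<sigma>"
    "\<And>w. w \<in> nonempty_words (carrier G) \<Longrightarrow>
      \<sigma> (word_code (carrier G) w) = Suc (to_nat_on (carrier G) (word_value G w))"
proof -
  interpret alg_semigroup G by fact
  let ?num = "to_nat_on (carrier G)"
  let ?acc = "case_option 0 (\<lambda>b. Suc (?num b))"
  let ?c = "\<lambda>(a, b). prod_encode (?num a, ?acc b)"
  let ?g = "\<lambda>(a, b). Suc (?num (case b of None \<Rightarrow> a | Some b \<Rightarrow> a \<otimes> b))"
  let ?A = "carrier G \<times> insert None (Some ` carrier G)"
  have "inj_on ?c ?A"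
    using inj_on_to_nat_on_finite[OF assms(2)] by (auto simp: inj_on_def)
  then obtain t where t: "computable t" "\<And>z. z \<in> ?A \<Longrightarrow> t (?c z) = ?g z"
    using computable_table[of ?A ?c ?g] assms(2) by auto
  define \<sigma> where "\<sigma> n = fold (\<lambda>a b. t (prod_encode (a, b))) (list_decode (rev_code n)) 0" for n
  have "computable \<sigma>"
    unfolding \<sigma>_def[abs_def]
    by (intro computable_fold computable_list_intros computable_comp[OF t(1)])
  moreover have "\<sigma> (word_code (carrier G) w) = Suc (?num (word_value G w))"
    if "w \<in> nonempty_words (carrier G)" for w
  proof -
    have "fold (\<lambda>a b. t (prod_encode (a, b))) (rev (map ?num w)) 0 = Suc (?num (word_value G w))"
      using that
    proof (induction rule: nonempty_words_induct)
      case (single x)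
      then show ?case using t(2)[of "(x, None)"] by simp
    next
      case (Cons x w)
      then show ?case using t(2)[of "(x, Some (word_value G w))"] word_value_closed[of w]
          nonempty_wordsD[OF Cons(2)] by (simp add: word_value_Cons)
    qed
    then show ?thesis by (simp add: \<sigma>_def word_code_def rev_code)
  qed
  ultimately show thesis by (rule that)
qed

text \<open>
  If every letter \<open>y\<close> is the product of the letters \<open>p y\<close> and \<open>q y\<close>, splitting the head of a word
  lengthens it by one letter without changing its value.  Padding \<open>u\<close> along \<open>v\<close> does this once for
  every letter of \<open>v\<close>; so \<open>u\<close> padded along \<open>v\<close> and \<open>v\<close> padded along \<open>u\<close> have the same length, and no
  lengths need to be compared.
\<close>

definition split_head :: "('a \<Rightarrow> 'a) \<Rightarrow> ('a \<Rightarrow> 'a) \<Rightarrow> 'a list \<Rightarrow> 'a list" where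
  "split_head p q w = p (hd w) # q (hd w) # tl w"

definition pad :: "('a \<Rightarrow> 'a) \<Rightarrow> ('a \<Rightarrow> 'a) \<Rightarrow> 'a list \<Rightarrow> 'a list \<Rightarrow> 'a list" where
  "pad p q v u = fold (\<lambda>_. split_head p q) v u"

lemma pad_properties:
  fixes G (structure)
  assumes G: "alg_semigroup G" and Y: "Y \<subseteq> carrier G"
    and pq: "\<And>y. y \<in> Y \<Longrightarrow> p y \<in> Y" "\<And>y. y \<in> Y \<Longrightarrow> q y \<in> Y"
      "\<And>y. y \<in> Y \<Longrightarrow> y = p y \<otimes>\<^bsub>G\<^esub> q y"
    and u: "u \<in> nonempty_words Y"
  shows "pad p q v u \<in> nonempty_words Y" "word_value G (pad p q v u) = word_value G u"
    "length (pad p q v u) = length v + length u"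
proof -
  interpret alg_semigroup G by fact
  have split: "split_head p q w \<in> nonempty_words Y \<and> word_value G (split_head p q w) = word_value G w
      \<and> length (split_head p q w) = Suc (length w)" if w: "w \<in> nonempty_words Y" for w
  proof -
    obtain y w' where eq: "w = y # w'" using nonempty_wordsD[OF w] by (cases w) auto
    then have y: "y \<in> Y" and w': "w' = [] \<or> w' \<in> nonempty_words Y"
      using w by (auto simp: nonempty_words_Cons)
    have "word_value G (split_head p q w) = word_value G w"
    proof (cases "w' = []")
      case True
      then show ?thesis using pq(3)[OF y] by (simp add: split_head_def eq)
    next
      case False
      then have "word_value G w' \<in> carrier G"
        using w' word_value_closed nonempty_words_mono[OF Y] by blast
      moreover have "p y \<in> carrier G" "q y \<in> carrier G" using pq(1,2)[OF y] Y by auto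
      ultimately have "p y \<otimes> (q y \<otimes> word_value G w') = y \<otimes> word_value G w'"
        using pq(3)[OF y] m_assoc by metis
      then show ?thesis using False by (simp add: split_head_def eq word_value_Cons)
    qed
    then show ?thesis
      using eq y w' pq by (auto simp: split_head_def nonempty_words_Cons)
  qed
  have "pad p q v u \<in> nonempty_words Y \<and> word_value G (pad p q v u) = word_value G u
    \<and> length (pad p q v u) = length v + length u"
    using u unfolding pad_def by (induction v arbitrary: u) (use split in auto)
  then show "pad p q v u \<in> nonempty_words Y" "word_value G (pad p q v u) = word_value G u"
    "length (pad p q v u) = length v + length u" by auto
qed

lemma computable_pad:
  assumes X: "finite X" and pq: "\<And>x. x \<in> X \<Longrightarrow> p x \<in> X" "\<And>x. x \<in> X \<Longrightarrow> q x \<in> X"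
  obtains \<sigma> where "computable \<sigma>"
    "\<And>u v. u \<in> nonempty_words X \<Longrightarrow> v \<in> nonempty_words X \<Longrightarrow>
      \<sigma> (pair_code X (u, v)) = pair_code X (pad p q v u, pad p q u v)"
proof -
  let ?num = "to_nat_on X"
  have table: "\<exists>t. computable t \<and> (\<forall>x\<in>X. t (?num x) = ?num (g x))" for g
    using computable_table[OF X inj_on_to_nat_on_finite[OF X], of "\<lambda>x. ?num (g x)"] by metis
  obtain s where s: "computable s" "\<And>x. x \<in> X \<Longrightarrow> s (?num x) = ?num (p x)" using table by blast
  obtain t where t: "computable t" "\<And>x. x \<in> X \<Longrightarrow> t (?num x) = ?num (q x)" using table by blast
  define split where "split n =
    cons_code (s (hd_code n)) (cons_code (t (hd_code n)) (tl_code n))" for n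
  define pad_code where "pad_code n m = fold (\<lambda>_. split) (list_decode n) m" for n m
  define \<sigma> where "\<sigma> n = prod_encode
    (pad_code (snd (prod_decode n)) (fst (prod_decode n)),
     pad_code (fst (prod_decode n)) (snd (prod_decode n)))" for n
  have "computable \<sigma>"
    unfolding \<sigma>_def[abs_def] pad_code_def split_def
    by (intro computable_list_intros computable_fold computable_comp[OF s(1)] computable_comp[OF t(1)])
  moreover have "\<sigma> (pair_code X (u, v)) = pair_code X (pad p q v u, pad p q u v)"
    if uv: "u \<in> nonempty_words X" "v \<in> nonempty_words X" for u v
  proof -
    have split: "split (word_code X w) = word_code X (split_head p q w)
        \<and> split_head p q w \<in> nonempty_words X" if w: "w \<in> nonempty_words X" for w
    proof -
      obtain x w' where "w = x # w'" using nonempty_wordsD[OF w] by (cases w) auto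
      with w show ?thesis
        using s(2)[of x] t(2)[of x] pq
        by (auto simp: split_def split_head_def word_code_def hd_code tl_code cons_code
            nonempty_words_Cons simp del: list_encode.simps)
    qed
    have "pad_code (word_code X v) (word_code X w) = word_code X (pad p q v w)"
      if "w \<in> nonempty_words X" for v w
    proof -
      have "fold (\<lambda>_. split) (map ?num v) (word_code X w) = word_code X (fold (\<lambda>_. split_head p q) v w)"
        using that by (induction v arbitrary: w) (use split in auto)
      then show ?thesis by (simp add: pad_code_def pad_def) (simp add: word_code_def)
    qed
    then show ?thesis using uv by (simp add: \<sigma>_def pair_code_def)
  qed
  ultimately show thesis by (rule that)
qed

lemma decidable_word_pairs_code:
  "decidable_word_pairs X R \<longleftrightarrow> decidable_set (pair_code X ` R)"
  by (simp add: decidable_word_pairs_def pair_code_def)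


section \<open>The two reductions\<close>

lemma word_problem_decidable_if_finite:
  assumes "alg_semigroup G" "finite (carrier G)"
  shows "word_problem_decidable G"
proof -
  interpret alg_semigroup G by fact
  let ?Y = "carrier G"
  have "[a] \<in> nonempty_words ?Y" "word_value G [a] = a" if "a \<in> ?Y" for a
    using that by (auto simp: nonempty_words_def)
  then have "?Y \<subseteq> word_value G ` nonempty_words ?Y"
    by (metis image_eqI subsetI)
  then have gen: "generating_set G ?Y"
    unfolding generating_set_def using word_value_closed by blast
  obtain \<sigma> where \<sigma>: "computable \<sigma>" "\<And>w. w \<in> nonempty_words ?Y \<Longrightarrow>
      \<sigma> (word_code ?Y w) = Suc (to_nat_on ?Y (word_value G w))"
    using computable_word_value_finite[OF assms] by blast
  have eq: "\<sigma> (word_code ?Y u) = \<sigma> (word_code ?Y v) \<longleftrightarrow> word_value G u = word_value G v"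
    if "u \<in> nonempty_words ?Y" "v \<in> nonempty_words ?Y" for u v
    using that inj_on_to_nat_on_finite[OF assms(2)] word_value_closed
    by (auto simp: \<sigma>(2) dest: inj_onD)
  let ?D = "pair_code ?Y ` (nonempty_words ?Y \<times> nonempty_words ?Y)"
  have "pair_code ?Y ` word_problem G ?Y
      = {n. n \<in> ?D \<and> \<sigma> (fst (prod_decode n)) = \<sigma> (snd (prod_decode n))}"
    using eq by (fastforce simp: word_problem_def pair_code_def)
  moreover have "decidable_set {n. \<sigma> (fst (prod_decode n)) = \<sigma> (snd (prod_decode n))}"
    by (intro decidable_set_eq computable_comp[OF \<sigma>(1)] computable_intros)
  ultimately have "decidable_word_pairs ?Y (word_problem G ?Y)"
    using decidable_nonempty_word_pairs[OF assms(2)]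
    by (simp add: decidable_word_pairs_code decidable_set_conj)
  with gen assms(2) show ?thesis unfolding word_problem_decidable_def by blast
qed

locale fiber_product_setup =
  fixes S :: "('a, 'm) monoid_scheme" and T :: "('b, 'n) monoid_scheme"
    and F :: "('c, 'k) monoid_scheme"
    and \<phi> :: "'a \<Rightarrow> 'c" and \<psi> :: "'b \<Rightarrow> 'c"
  assumes S: "alg_semigroup S" and T: "alg_semigroup T" and F: "alg_semigroup F"
    and fg: "finitely_generated (S \<times>\<times> T)"
    and \<phi>: "\<phi> \<in> hom S F" "\<phi> ` carrier S = carrier F"
    and \<psi>: "\<psi> \<in> hom T F" "\<psi> ` carrier T = carrier F"
begin

abbreviation "P \<equiv> S \<times>\<times> T"

lemma P: "alg_semigroup P"
  using S T by (rule alg_semigroup_DirProd)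

lemma hom_fst: "(\<lambda>x. \<phi> (fst x)) \<in> hom P F"
  using \<phi>(1) by (auto simp: hom_def)

lemma hom_snd: "(\<lambda>x. \<psi> (snd x)) \<in> hom P F"
  using \<psi>(1) by (auto simp: hom_def)

lemma image_fst:
  assumes "carrier F \<noteq> {}"
  shows "(\<lambda>x. \<phi> (fst x)) ` carrier P = carrier F"
proof -
  have "carrier T \<noteq> {}" using assms \<psi>(2) by auto
  then have "fst ` carrier P = carrier S" by auto
  then show ?thesis using \<phi>(2) by (metis image_image)
qed

lemma value_in_fiber_product_iff:
  assumes "w \<in> nonempty_words (carrier P)"
  shows "word_value P w \<in> fiber_product S T \<phi> \<psi> \<longleftrightarrow>
    word_value F (map (\<lambda>x. \<phi> (fst x)) w) = word_value F (map (\<lambda>x. \<psi> (snd x)) w)"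
  using alg_semigroup.word_value_closed[OF P assms]
    word_value_map_hom[OF P hom_fst assms] word_value_map_hom[OF P hom_snd assms]
  by (auto simp: fiber_product_def)

text \<open>
  Writing \<open>\<phi> (fst x)\<close> and \<open>\<psi> (snd x)\<close> for every generator \<open>x\<close> as words over the generators of \<open>F\<close>
  turns a word over \<open>X\<close> into a pair of words, and its value lies in the fiber product iff these have
  the same value in \<open>F\<close>.
\<close>

lemma generalized_word_problem_decidable_if:
  assumes "word_problem_decidable F"
  shows "generalized_word_problem_decidable P (fiber_product S T \<phi> \<psi>)"
proof -
  from assms obtain Y where Y: "finite Y" "generating_set F Y"
    and dec: "decidable_set (pair_code Y ` word_problem F Y)"
    unfolding word_problem_decidable_def decidable_word_pairs_code by blast
  from fg obtain X where X: "finite X" "generating_set P X"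
    unfolding finitely_generated_def by blast
  have XP: "X \<subseteq> carrier P" and YF: "Y \<subseteq> carrier F" using X Y by (auto simp: generating_set_def)
  obtain h where h: "\<And>a. a \<in> carrier F \<Longrightarrow> h a \<in> nonempty_words Y"
    "\<And>a. a \<in> carrier F \<Longrightarrow> word_value F (h a) = a"
    using generating_set_choose[OF Y(2)] by blast
  have left: "\<phi> (fst x) \<in> carrier F" and right: "\<psi> (snd x) \<in> carrier F" if "x \<in> X" for x
    using that XP hom_fst hom_snd by (auto simp: hom_def)
  let ?l = "\<lambda>w. concat (map (\<lambda>x. h (\<phi> (fst x))) w)" and ?r = "\<lambda>w. concat (map (\<lambda>x. h (\<psi> (snd x))) w)"
  have words: "?l w \<in> nonempty_words Y" "?r w \<in> nonempty_words Y" if "w \<in> nonempty_words X" for w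
    using that by (auto intro!: nonempty_words_concat_map h left right)
  have "word_value P w \<in> fiber_product S T \<phi> \<psi> \<longleftrightarrow> (?l w, ?r w) \<in> word_problem F Y"
    if w: "w \<in> nonempty_words X" for w
  proof -
    have mem: "set w \<subseteq> X" using w by (auto simp: nonempty_words_def)
    have hF: "h a \<in> nonempty_words (carrier F)" if "a \<in> carrier F" for a
      using h(1)[OF that] nonempty_words_mono[OF YF] by blast
    have "word_value F (?l w) = word_value F (map (\<lambda>x. word_value F (h (\<phi> (fst x)))) w)"
      by (rule alg_semigroup.word_value_concat_map[OF F w]) (intro hF left)
    also have "map (\<lambda>x. word_value F (h (\<phi> (fst x)))) w = map (\<lambda>x. \<phi> (fst x)) w"
      using mem h(2) left by auto
    finally have l: "word_value F (?l w) = word_value F (map (\<lambda>x. \<phi> (fst x)) w)" .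
    have "word_value F (?r w) = word_value F (map (\<lambda>x. word_value F (h (\<psi> (snd x)))) w)"
      by (rule alg_semigroup.word_value_concat_map[OF F w]) (intro hF right)
    also have "map (\<lambda>x. word_value F (h (\<psi> (snd x)))) w = map (\<lambda>x. \<psi> (snd x)) w"
      using mem h(2) right by auto
    finally have r: "word_value F (?r w) = word_value F (map (\<lambda>x. \<psi> (snd x)) w)" .
    show ?thesis
      using value_in_fiber_product_iff[OF nonempty_words_mono[OF XP w]] words[OF w] l r
      by (simp add: word_problem_def)
  qed
  then have eq: "generalized_word_problem P (fiber_product S T \<phi> \<psi>) X
      = {w \<in> nonempty_words X. (?l w, ?r w) \<in> word_problem F Y}"
    by (auto simp: generalized_word_problem_def)
  obtain \<sigma> where \<sigma>: "computable \<sigma>" "\<And>w. w \<in> lists X \<Longrightarrow> \<sigma> (word_code X w) = word_code Y (?l w)"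
    using computable_substitution[OF X(1)] by blast
  obtain \<tau> where \<tau>: "computable \<tau>" "\<And>w. w \<in> lists X \<Longrightarrow> \<tau> (word_code X w) = word_code Y (?r w)"
    using computable_substitution[OF X(1)] by blast
  have "decidable_set (word_code X ` {w \<in> nonempty_words X. (?l w, ?r w) \<in> word_problem F Y})"
  proof (rule decidable_set_reduction)
    show "decidable_set (word_code X ` nonempty_words X)"
      using X(1) by (rule decidable_nonempty_words)
    show "decidable_set (pair_code Y ` word_problem F Y)" by fact
    show "inj_on (pair_code Y) (lists Y \<times> lists Y)" using Y(1) by (rule inj_on_pair_code)
    show "word_problem F Y \<subseteq> lists Y \<times> lists Y"
      by (auto simp: word_problem_def nonempty_words_def)
    show "computable (\<lambda>n. prod_encode (\<sigma> n, \<tau> n))" using \<sigma>(1) \<tau>(1) by (rule computable_prod_encode)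
    show "(?l w, ?r w) \<in> lists Y \<times> lists Y" if "w \<in> nonempty_words X" for w
      using words[OF that] by (simp add: nonempty_words_def)
    show "prod_encode (\<sigma> (word_code X w), \<tau> (word_code X w)) = pair_code Y (?l w, ?r w)"
      if "w \<in> nonempty_words X" for w
      using that \<sigma>(2) \<tau>(2) by (simp add: pair_code_def nonempty_words_def)
  qed
  then show ?thesis
    using X unfolding generalized_word_problem_decidable_def decidable_words_def eq[symmetric] by blast
qed

text \<open>
  Lift every letter \<open>y\<close> to \<open>s y\<close> in \<open>S\<close> and \<open>t y\<close> in \<open>T\<close>.  For words \<open>u\<close> and \<open>v\<close> of equal length,
  the product of the pairs of lifts of corresponding letters is an element of \<open>S \<times>\<times> T\<close> whose
  components lie over \<open>u\<close> and \<open>v\<close>, and it is in the fiber product iff \<open>u\<close> and \<open>v\<close> agree in \<open>F\<close>.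
  A factor of one component alone cannot be supplied without an identity in the other, so words of
  different lengths are padded first, which is possible when \<open>F\<close> is infinite.
\<close>

lemma word_problem_decidable_if:
  assumes "generalized_word_problem_decidable P (fiber_product S T \<phi> \<psi>)"
  shows "word_problem_decidable F"
proof (cases "finite (carrier F)")
  case True
  with F show ?thesis by (rule word_problem_decidable_if_finite)
next
  case False
  from assms obtain X where X: "finite X" "generating_set P X"
    and dec: "decidable_set (word_code X ` generalized_word_problem P (fiber_product S T \<phi> \<psi>) X)"
    unfolding generalized_word_problem_decidable_def decidable_words_def by blast
  have XP: "X \<subseteq> carrier P" using X(2) by (auto simp: generating_set_def)
  have "carrier F \<noteq> {}" using False by auto
  then have gen: "generating_set F ((\<lambda>x. \<phi> (fst x)) ` X)"
    by (intro generating_set_hom_image[OF P hom_fst] image_fst X(2))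
  have square: "\<exists>b\<in>carrier F. \<exists>c\<in>carrier F. a = b \<otimes>\<^bsub>F\<^esub> c" if "a \<in> carrier F" for a
    using product_decomposition_if_product_finitely_generated[OF S T fg \<phi> \<psi>(2) False that] .
  obtain Y p q where Y: "finite Y" "generating_set F Y"
    and pq: "\<And>y. y \<in> Y \<Longrightarrow> p y \<in> Y" "\<And>y. y \<in> Y \<Longrightarrow> q y \<in> Y" "\<And>y. y \<in> Y \<Longrightarrow> y = p y \<otimes>\<^bsub>F\<^esub> q y"
    using generating_set_splitting[OF F finite_imageI[OF X(1)] gen square] by blast
  have YF: "Y \<subseteq> carrier F" using Y(2) by (auto simp: generating_set_def)
  define s where "s = inv_into (carrier S) \<phi>"
  define t where "t = inv_into (carrier T) \<psi>"
  have s: "s y \<in> carrier S" "\<phi> (s y) = y" if "y \<in> carrier F" for y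
    using that unfolding s_def by (simp_all add: \<phi>(2)[symmetric] inv_into_into f_inv_into_f)
  have t: "t y \<in> carrier T" "\<psi> (t y) = y" if "y \<in> carrier F" for y
    using that unfolding t_def by (simp_all add: \<psi>(2)[symmetric] inv_into_into f_inv_into_f)
  obtain g where g: "\<And>a. a \<in> carrier P \<Longrightarrow> g a \<in> nonempty_words X"
    "\<And>a. a \<in> carrier P \<Longrightarrow> word_value P (g a) = a"
    using generating_set_choose[OF X(2)] by blast
  let ?lift = "\<lambda>z. (s (fst z), t (snd z))"
  define h where "h z = g (?lift z)" for z
  have lift: "?lift z \<in> carrier P" if "z \<in> Y \<times> Y" for z
    using that YF s(1) t(1) by auto
  have h: "h z \<in> nonempty_words X" "word_value P (h z) = ?lift z" if "z \<in> Y \<times> Y" for z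
    using g lift[OF that] by (auto simp: h_def)
  define f where "f = (\<lambda>(u, v). concat (map h (zip (pad p q v u) (pad p q u v))))"
  have pad: "pad p q v u \<in> nonempty_words Y" "word_value F (pad p q v u) = word_value F u"
    "length (pad p q v u) = length v + length u" if "u \<in> nonempty_words Y" for u v
    by (rule pad_properties[OF F YF]; (rule pq that | assumption)+)+
  have f: "f (u, v) \<in> nonempty_words X"
    "word_value P (f (u, v)) \<in> fiber_product S T \<phi> \<psi> \<longleftrightarrow> word_value F u = word_value F v"
    if uv: "u \<in> nonempty_words Y" "v \<in> nonempty_words Y" for u v
  proof -
    let ?z = "zip (pad p q v u) (pad p q u v)"
    have len: "length (pad p q v u) = length (pad p q u v)" using pad(3) uv by simp
    have z: "?z \<in> nonempty_words (Y \<times> Y)"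
      using pad(1) uv
      by (auto simp: nonempty_words_def zip_eq_Nil_iff in_lists_conv_set dest: set_zip_leftD set_zip_rightD)
    then show "f (u, v) \<in> nonempty_words X"
      using h(1) by (auto simp: f_def intro: nonempty_words_concat_map)
    have setz: "set ?z \<subseteq> Y \<times> Y" using z by (auto simp: nonempty_words_def)
    have "word_value P (f (u, v)) = word_value P (map (\<lambda>z. word_value P (h z)) ?z)"
      unfolding f_def prod.case
      by (rule alg_semigroup.word_value_concat_map[OF P z]) (intro nonempty_words_mono[OF XP] h(1))
    also have "map (\<lambda>z. word_value P (h z)) ?z = map ?lift ?z"
      using setz h(2) by (intro map_cong) auto
    finally have eq: "word_value P (f (u, v)) = word_value P (map ?lift ?z)" .
    have "map (\<lambda>x. \<phi> (fst x)) (map ?lift ?z) = map fst ?z"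
      using setz s(2) YF by auto
    moreover have "map (\<lambda>x. \<psi> (snd x)) (map ?lift ?z) = map snd ?z"
      using setz t(2) YF by auto
    moreover have "map ?lift ?z \<in> nonempty_words (carrier P)"
      using z lift by (rule nonempty_words_map)
    ultimately show "word_value P (f (u, v)) \<in> fiber_product S T \<phi> \<psi> \<longleftrightarrow>
        word_value F u = word_value F v"
      using len pad(2) uv unfolding eq by (simp add: value_in_fiber_product_iff del: map_map)
  qed
  then have eq: "word_problem F Y = {x \<in> nonempty_words Y \<times> nonempty_words Y.
      f x \<in> generalized_word_problem P (fiber_product S T \<phi> \<psi>) X}"
    by (auto simp: word_problem_def generalized_word_problem_def)
  obtain \<sigma> where \<sigma>: "computable \<sigma>" "\<And>u v. u \<in> nonempty_words Y \<Longrightarrow> v \<in> nonempty_words Y \<Longrightarrow>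
      \<sigma> (pair_code Y (u, v)) = pair_code Y (pad p q v u, pad p q u v)"
    using computable_pad[of Y p q, OF Y(1) pq(1,2)] by blast
  obtain \<tau> where \<tau>: "computable \<tau>" "\<And>u v. u \<in> lists Y \<Longrightarrow> v \<in> lists Y \<Longrightarrow> length u = length v \<Longrightarrow>
      \<tau> (pair_code Y (u, v)) = word_code X (concat (map h (zip u v)))"
    using computable_zip_substitution[OF Y(1)] by blast
  have "decidable_set (pair_code Y ` {x \<in> nonempty_words Y \<times> nonempty_words Y.
      f x \<in> generalized_word_problem P (fiber_product S T \<phi> \<psi>) X})"
  proof (rule decidable_set_reduction)
    show "decidable_set (pair_code Y ` (nonempty_words Y \<times> nonempty_words Y))"
      using Y(1) by (rule decidable_nonempty_word_pairs)
    show "inj_on (word_code X) (lists X)" using X(1) by (rule inj_on_word_code)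
    show "generalized_word_problem P (fiber_product S T \<phi> \<psi>) X \<subseteq> lists X"
      by (auto simp: generalized_word_problem_def nonempty_words_def)
    show "computable (\<lambda>n. \<tau> (\<sigma> n))" using \<tau>(1) \<sigma>(1) by (rule computable_comp)
    show "f x \<in> lists X" if "x \<in> nonempty_words Y \<times> nonempty_words Y" for x
      using that f(1) by (cases x) (simp add: nonempty_words_def)
    show "\<tau> (\<sigma> (pair_code Y x)) = word_code X (f x)"
      if x: "x \<in> nonempty_words Y \<times> nonempty_words Y" for x
    proof -
      obtain u v where uv: "x = (u, v)" "u \<in> nonempty_words Y" "v \<in> nonempty_words Y" using x by auto
      have "\<tau> (pair_code Y (pad p q v u, pad p q u v)) = word_code X (f (u, v))"
        unfolding f_def prod.case
        using pad(1,3)[OF uv(2)] pad(1,3)[OF uv(3)] by (intro \<tau>(2)) (auto simp: nonempty_words_def)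
      then show ?thesis using uv \<sigma>(2) by simp
    qed
  qed fact
  then show ?thesis
    using Y unfolding word_problem_decidable_def decidable_word_pairs_code eq[symmetric] by blast
qed

end

theorem lemma5p1:
  fixes S :: "('a, 'm) monoid_scheme" and T :: "('b, 'n) monoid_scheme"
    and F :: "('c, 'k) monoid_scheme"
    and \<phi> :: "'a \<Rightarrow> 'c" and \<psi> :: "'b \<Rightarrow> 'c"
  assumes "alg_semigroup S" and "alg_semigroup T" and "alg_semigroup F"
    and "finitely_generated (S \<times>\<times> T)"
    and "\<phi> \<in> epi S F" and "\<psi> \<in> epi T F"
    and "finitely_generated ((S \<times>\<times> T)\<lparr>carrier := fiber_product S T \<phi> \<psi>\<rparr>)"
  shows "generalized_word_problem_decidable (S \<times>\<times> T) (fiber_product S T \<phi> \<psi>)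
    \<longleftrightarrow> word_problem_decidable F"
proof -
  interpret fiber_product_setup S T F \<phi> \<psi>
    using assms by (intro fiber_product_setup.intro) (auto simp: epi_def)
  show ?thesis
    using generalized_word_problem_decidable_if word_problem_decidable_if by blast
qed

end
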